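(* For any integer $k \geq 3$ and any integer $v \geq 3k^2 - 1$, there is a $(v,k)$-modular Golomb ruler.
   Context: For an integer $k\ge 3$ and a positive integer $v$, a $(v,k)$-modular Golomb ruler ($(v,k)$-MGR) is a set of $k$ distinct integers $0 \leq x_1 < x_2 < \cdots < x_k \leq v-1$ such that all the differences $x_j - x_i \bmod v$ (over ordered pairs $(i,j)$ with $i \neq j$) are distinct elements of $\mathbb{Z}_v$. *)

theory Defs
  imports Main
begin

text \<open>Elements of \<open>\<int>\<^sub>v\<close> are represented by their residues in \<open>{0..v - 1}\<close>; \<open>mod\<close> on
  \<^typ>\<open>int\<close> always yields this representative, also for negative differences.\<close>

definition modular_golomb_ruler :: "nat \<Rightarrow> nat \<Rightarrow> int set \<Rightarrow> bool" where
  "modular_golomb_ruler v k X \<longleftrightarrow>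
     3 \<le> k \<and> 0 < v \<and> X \<subseteq> {0..int v - 1} \<and> card X = k \<and>
     inj_on (\<lambda>(x, y). (y - x) mod int v) {(x, y). x \<in> X \<and> y \<in> X \<and> x \<noteq> y}"

end

theory Submission
  imports Defs "HOL-Number_Theory.Residue_Primitive_Roots" "HOL-Number_Theory.Prime_Powers"
    "HOL-Analysis.Harmonic_Numbers" "HOL-Analysis.Complex_Transcendental"
begin

text \<open>
  A set \<open>X \<subseteq> {0..L}\<close> of integers whose pairwise differences are distinct is a modular Golomb ruler
  for every modulus \<open>v > 2L\<close>: differences lie in \<open>[-L, L]\<close>, so congruence modulo \<open>v\<close> is equality.
  It thus suffices to find a ruler with \<open>k\<close> marks and \<open>2L \<le> 3k\<^sup>2 - 3 = 3(k - 1)(k + 1)\<close>.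

  For a prime \<open>p\<close>, Ruzsa's construction gives a Sidon set of \<open>p - 1\<close> elements modulo \<open>p(p - 1)\<close>
  (\<open>ruzsa_sidon_set\<close>). Its density is \<open>1/p\<close>, so if \<open>k < p\<close>, some cyclic window of length
  \<open>L = (k - 1) p\<close> contains \<open>k\<close> of its elements (\<open>short_sidon_set\<close>). The required bound on \<open>L\<close> holds
  if \<open>k + 1 \<le> p \<le> 3(k + 1)/2\<close>, so everything reduces to a sharpening of Bertrand's postulate: for
  \<open>n \<ge> 2\<close> there is a prime in \<open>[n, 3n/2]\<close> (\<open>prime_between\<close>).

  That is proved by Chebyshev's method. The logarithm of \<open>(30N)! N! / ((15N)! (10N)! (6N)!)\<close> equals
  the sum of \<open>\<Lambda>(d) w(\<lfloor>30N/d\<rfloor>)\<close> over \<open>d \<le> 30N\<close> with a weight \<open>w\<close> that only takes the values \<open>0\<close> and \<open>1\<close>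
  and is \<open>1\<close> on \<open>1, \<dots>, 5\<close>. Hence it lies between \<open>\<psi>(30N) - \<psi>(5N)\<close> and \<open>\<psi>(30N)\<close>, while elementary
  bounds for \<open>ln n!\<close> show that it is \<open>27.6\<dots> N + O(ln N)\<close>. This yields
  \<open>27.6 N - O(ln N) \<le> \<psi>(30N) \<le> 36 N + O(1)\<close>, and \<open>27.6 \<cdot> 3/2 > 36\<close> makes \<open>\<psi>\<close> grow linearly between \<open>n\<close>
  and \<open>3n/2\<close>, which proper prime powers cannot account for when \<open>n \<ge> 2\<^sup>1\<^sup>3\<close>
  (\<open>prime_between_large\<close>). Smaller \<open>n\<close> are covered by an explicit chain of primes.
\<close>

section \<open>Short Sidon sets\<close>

text \<open>A Sidon set in \<open>\<int>\<^sub>M\<close>, presented by integers: two sums of two elements agree modulo \<open>M\<close>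
  only if the summands agree up to order. Concluding just \<open>a = b \<or> a = c\<close> is enough, because the
  remaining summands are then congruent modulo \<open>M\<close>.\<close>

definition sidon_mod :: "int \<Rightarrow> int set \<Rightarrow> bool" where
  "sidon_mod M S \<longleftrightarrow>
     (\<forall>a\<in>S. \<forall>b\<in>S. \<forall>c\<in>S. \<forall>d\<in>S. [a + d = b + c] (mod M) \<longrightarrow> a = b \<or> a = c)"

text \<open>The hypotheses say that \<open>(X - a)(X - d)\<close> and \<open>(X - b)(X - c)\<close> are the same polynomial modulo \<open>p\<close>;
  evaluate at \<open>X = a\<close>.\<close>

lemma equal_sum_product_cong:
  fixes p a b c d :: int
  assumes "prime p" "[a + d = b + c] (mod p)" "[a * d = b * c] (mod p)"
  shows "[a = b] (mod p) \<or> [a = c] (mod p)"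
proof -
  have "(a - b) * (a - c) = a * ((a + d) - (b + c)) - (a * d - b * c)"
    by (simp add: algebra_simps)
  moreover have "p dvd a * ((a + d) - (b + c)) - (a * d - b * c)"
    using assms(2,3) by (meson cong_iff_dvd_diff dvd_diff dvd_mult)
  ultimately have "p dvd (a - b) * (a - c)" by simp
  thus ?thesis
    using assms(1) by (simp add: cong_iff_dvd_diff prime_dvd_mult_iff)
qed

text \<open>Ruzsa's construction: for a primitive root \<open>g\<close>, the \<open>i\<close>-th element is congruent to \<open>i\<close> modulo
  \<open>p - 1\<close> and to \<open>g\<^sup>i\<close> modulo \<open>p\<close>. A coincidence of sums fixes the product \<open>g\<^sup>i g\<^sup>l\<close> through the
  first modulus and the sum \<open>g\<^sup>i + g\<^sup>l\<close> through the second.\<close>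

lemma ruzsa_sidon_set:
  fixes p :: nat
  assumes "prime p"
  obtains S where "S \<subseteq> {0..<int p * (int p - 1)}" "card S = p - 1"
    "sidon_mod (int p * (int p - 1)) S"
proof -
  have p: "p > 1" using assms by (rule prime_gt_1_nat)
  obtain g where g: "residue_primroot p g"
    using prime_primitive_root_exists[OF p assms] by blast
  have cop: "coprime p g" and ord: "ord p g = p - 1"
    using g assms by (auto simp: residue_primroot_def totient_prime)
  define M where "M = int p * (int p - 1)"
  \<comment> \<open>The explicit solution of the two congruences, using \<open>p \<equiv> 1\<close> modulo \<open>p - 1\<close>.\<close>
  define a where "a i = (int p * int i - (int p - 1) * int g ^ i) mod M" for i :: nat
  have M: "M > 0" using p by (simp add: M_def)
  have mod_p1: "[a i = int i] (mod (int p - 1))" for i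
  proof -
    have "[a i = int p * int i - (int p - 1) * int g ^ i] (mod (int p - 1))"
      unfolding a_def by (rule cong_dvd_modulus[of _ _ M]) (auto simp: M_def)
    also have "[int p * int i - (int p - 1) * int g ^ i = int i] (mod (int p - 1))"
      unfolding cong_iff_dvd_diff
      by (rule dvdI[of _ _ "int i - int g ^ i"]) (simp add: algebra_simps)
    finally show ?thesis .
  qed
  have mod_p: "[a i = int g ^ i] (mod (int p))" for i
  proof -
    have "[a i = int p * int i - (int p - 1) * int g ^ i] (mod (int p))"
      unfolding a_def by (rule cong_dvd_modulus[of _ _ M]) (auto simp: M_def)
    also have "[int p * int i - (int p - 1) * int g ^ i = int g ^ i] (mod (int p))"
      unfolding cong_iff_dvd_diff
      by (rule dvdI[of _ _ "int i - int g ^ i"]) (simp add: algebra_simps)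
    finally show ?thesis .
  qed
  have pow_cong: "[int g ^ i = int g ^ j] (mod (int p)) \<longleftrightarrow> [i = j] (mod (p - 1))" for i j
    using order_divides_expdiff[OF cop, of i j] ord
    by (metis cong_int_iff of_nat_power)
  have pow_eq: "i = j" if "[int g ^ i = int g ^ j] (mod (int p))" "i < p - 1" "j < p - 1" for i j
    using that pow_cong by (simp add: cong_def)
  have sidon: "i = j \<or> i = k"
    if "[a i + a l = a j + a k] (mod M)" and lt: "i < p - 1" "j < p - 1" "k < p - 1" "l < p - 1"
    for i j k l
  proof -
    have "[a i + a l = a j + a k] (mod (int p - 1))"
      using that(1) by (rule cong_dvd_modulus) (simp add: M_def)
    hence "[int i + int l = int j + int k] (mod (int p - 1))"
      by (meson cong_add cong_sym cong_trans mod_p1)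
    hence "[i + l = j + k] (mod (p - 1))"
      using p by (simp add: of_nat_diff flip: cong_int_iff)
    hence prod: "[int g ^ i * int g ^ l = int g ^ j * int g ^ k] (mod (int p))"
      using pow_cong[of "i + l" "j + k"] by (simp add: power_add)
    have "[a i + a l = a j + a k] (mod (int p))"
      using that(1) by (rule cong_dvd_modulus) (simp add: M_def)
    hence "[int g ^ i + int g ^ l = int g ^ j + int g ^ k] (mod (int p))"
      by (meson cong_add cong_sym cong_trans mod_p)
    with prod have "[int g ^ i = int g ^ j] (mod (int p)) \<or> [int g ^ i = int g ^ k] (mod (int p))"
      using assms by (intro equal_sum_product_cong) auto
    thus ?thesis using pow_eq lt by blast
  qed
  have inj: "inj_on a {..<p - 1}"
  proof (rule inj_onI)
    fix i j assume ij: "i \<in> {..<p - 1}" "j \<in> {..<p - 1}" "a i = a j"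
    hence "[int g ^ i = int g ^ j] (mod (int p))"
      using mod_p by (metis cong_sym cong_trans)
    thus "i = j" using pow_eq ij by blast
  qed
  show ?thesis
  proof (rule that[of "a ` {..<p - 1}"])
    show "a ` {..<p - 1} \<subseteq> {0..<int p * (int p - 1)}"
      using M by (auto simp: a_def simp flip: M_def)
    show "card (a ` {..<p - 1}) = p - 1"
      using inj by (simp add: card_image)
    show "sidon_mod (int p * (int p - 1)) (a ` {..<p - 1})"
      unfolding sidon_mod_def M_def[symmetric] using sidon by blast
  qed
qed

text \<open>Averaging over all \<open>M\<close> cyclic windows of length \<open>L\<close>: every element of \<open>S\<close> lies in \<open>L + 1\<close> of
  them.\<close>

lemma exists_dense_cyclic_window:
  fixes M L :: int
  assumes "finite S" "0 \<le> L" "L < M"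
  shows "\<exists>t. int (card S) * (L + 1) \<le> M * int (card {s \<in> S. (s - t) mod M \<le> L})"
proof (rule ccontr)
  assume contr: "\<not> ?thesis"
  have window: "L + 1 \<le> int (card {t \<in> {0..<M}. (s - t) mod M \<le> L})" for s
  proof -
    have "inj_on (\<lambda>u. (s - u) mod M) {0..L}"
    proof (rule inj_onI)
      fix u w assume uw: "u \<in> {0..L}" "w \<in> {0..L}" "(s - u) mod M = (s - w) mod M"
      from uw(3) have "[s - u = s - w] (mod M)" by (simp only: cong_def)
      from cong_diff[OF cong_refl[of s] this]
      have "[u = w] (mod M)" by simp
      thus "u = w" using uw assms by (simp add: cong_def)
    qed
    moreover have "(\<lambda>u. (s - u) mod M) ` {0..L} \<subseteq> {t \<in> {0..<M}. (s - t) mod M \<le> L}"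
      using assms by (auto simp: mod_diff_right_eq)
    moreover have "finite {t \<in> {0..<M}. (s - t) mod M \<le> L}"
      by (rule finite_subset[of _ "{0..<M}"]) auto
    ultimately have "card {0..L} \<le> card {t \<in> {0..<M}. (s - t) mod M \<le> L}"
      by (rule card_inj_on_le)
    thus ?thesis using assms by simp
  qed
  have "(\<Sum>t\<in>{0..<M}. int (card {s \<in> S. (s - t) mod M \<le> L}))
      = (\<Sum>t\<in>{0..<M}. \<Sum>s | s \<in> S \<and> (s - t) mod M \<le> L. 1)" by simp
  also have "\<dots> = (\<Sum>s\<in>S. \<Sum>t | t \<in> {0..<M} \<and> (s - t) mod M \<le> L. 1)"
    using assms by (intro sum.swap_restrict) auto
  also have "\<dots> = (\<Sum>s\<in>S. int (card {t \<in> {0..<M}. (s - t) mod M \<le> L}))" by simp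
  finally have "int (card S) * (L + 1) \<le> (\<Sum>t\<in>{0..<M}. int (card {s \<in> S. (s - t) mod M \<le> L}))"
    using sum_mono[of S "\<lambda>_. L + 1", OF window] by simp
  hence "M * (int (card S) * (L + 1))
      \<le> M * (\<Sum>t\<in>{0..<M}. int (card {s \<in> S. (s - t) mod M \<le> L}))"
    using assms by (intro mult_left_mono) auto
  also have "\<dots> = (\<Sum>t\<in>{0..<M}. M * int (card {s \<in> S. (s - t) mod M \<le> L}))"
    by (rule sum_distrib_left)
  also have "\<dots> < (\<Sum>t\<in>{0..<M}. int (card S) * (L + 1))"
    using contr assms by (intro sum_strict_mono) (auto simp: not_le)
  also have "\<dots> = M * (int (card S) * (L + 1))"
    using assms by simp
  finally show False by simp
qed

lemma sidon_mod_translate: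
  assumes "sidon_mod M S" "S \<subseteq> {0..<M}"
  shows "inj_on (\<lambda>s. (s - t) mod M) S" "sidon_mod M ((\<lambda>s. (s - t) mod M) ` S)"
proof -
  show "inj_on (\<lambda>s. (s - t) mod M) S"
  proof (rule inj_onI)
    fix x y assume xy: "x \<in> S" "y \<in> S" "(x - t) mod M = (y - t) mod M"
    hence "[x - t + t = y - t + t] (mod M)"
      by (intro cong_add) (auto simp: cong_def)
    thus "x = y" using xy assms(2) by (auto simp: cong_def subset_iff)
  qed
  have "[a + d = b + c] (mod M)"
    if "[(a - t) mod M + (d - t) mod M = (b - t) mod M + (c - t) mod M] (mod M)" for a b c d
  proof -
    have "[(a - t) + (d - t) = (b - t) + (c - t)] (mod M)"
      using that by (simp add: cong_def mod_simps)
    hence "[(a - t) + (d - t) + 2 * t = (b - t) + (c - t) + 2 * t] (mod M)"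
      by (rule cong_add) (rule cong_refl)
    thus ?thesis by (simp add: algebra_simps)
  qed
  thus "sidon_mod M ((\<lambda>s. (s - t) mod M) ` S)"
    using assms(1) unfolding sidon_mod_def by blast
qed

text \<open>Ruzsa's set has density \<open>1 / p\<close>, so some window of length \<open>(k - 1) p\<close> contains more than
  \<open>k - 1\<close> of its elements; \<open>k\<close> of these are translated so that the window starts at \<open>0\<close>.\<close>

lemma short_sidon_set:
  fixes p k :: nat
  assumes "prime p" "0 < k" "k < p"
  obtains X where "X \<subseteq> {0..(int k - 1) * int p}" "card X = k" "sidon_mod (int p * (int p - 1)) X"
proof -
  define M L where "M = int p * (int p - 1)" and "L = (int k - 1) * int p"
  have L: "0 \<le> L" "L < M"
    using assms by (auto simp: M_def L_def)
  obtain S where S: "S \<subseteq> {0..<M}" "card S = p - 1" "sidon_mod M S"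
    using ruzsa_sidon_set[OF assms(1)] unfolding M_def by blast
  have fin: "finite S" using S(1) finite_subset by blast
  obtain t where t: "int (card S) * (L + 1) \<le> M * int (card {s \<in> S. (s - t) mod M \<le> L})"
    using exists_dense_cyclic_window[OF fin L] by blast
  define W where "W = {s \<in> S. (s - t) mod M \<le> L}"
  have "(int p - 1) * (L + 1) \<le> (int p - 1) * (int p * int (card W))"
    using t S(2) assms by (simp add: M_def W_def of_nat_diff algebra_simps)
  hence "L + 1 \<le> int p * int (card W)"
    using assms by simp
  hence "int p * (int k - 1) < int p * int (card W)"
    by (simp add: L_def algebra_simps)
  hence "k \<le> card W" using assms by simp
  then obtain Y where Y: "Y \<subseteq> W" "card Y = k" "finite Y"
    by (rule obtain_subset_with_card_n)
  have YS: "Y \<subseteq> S" using Y by (auto simp: W_def)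
  have sidY: "sidon_mod M Y" using S(3) YS unfolding sidon_mod_def by blast
  have subY: "Y \<subseteq> {0..<M}" using S(1) YS by blast
  show ?thesis
  proof (rule that[of "(\<lambda>s. (s - t) mod M) ` Y"])
    show "(\<lambda>s. (s - t) mod M) ` Y \<subseteq> {0..(int k - 1) * int p}"
      using Y(1) L by (auto simp: W_def simp flip: L_def)
    show "card ((\<lambda>s. (s - t) mod M) ` Y) = k"
      using sidon_mod_translate(1)[OF sidY subY] Y(2) by (simp add: card_image)
    show "sidon_mod (int p * (int p - 1)) ((\<lambda>s. (s - t) mod M) ` Y)"
      using sidon_mod_translate(2)[OF sidY subY] by (simp flip: M_def)
  qed
qed

section \<open>Chebyshev estimates\<close>

text \<open>Chebyshev's function: the logarithm of the least common multiple of \<open>1, \<dots>, n\<close>.\<close>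

definition chebyshev_psi :: "nat \<Rightarrow> real" where
  "chebyshev_psi n = (\<Sum>d\<in>{1..n}. mangoldt d)"

lemma chebyshev_psi_mono: "m \<le> n \<Longrightarrow> chebyshev_psi m \<le> chebyshev_psi n"
  unfolding chebyshev_psi_def by (intro sum_mono2) (auto simp: mangoldt_nonneg)

text \<open>Legendre's formula for \<open>n!\<close>. The upper summation limit \<open>m\<close> is free (terms with \<open>d > n\<close>
  vanish), so that factorials of different sizes can be combined termwise.\<close>

lemma ln_fact_mangoldt:
  assumes "n \<le> m"
  shows "ln (fact n) = (\<Sum>d\<in>{1..m}. mangoldt d * real (n div d))"
  using assms
proof (induction n)
  case (Suc n)
  have "(\<Sum>d\<in>{1..m}. mangoldt d * real (Suc n div d))
      = (\<Sum>d\<in>{1..m}. mangoldt d * real (n div d) + (if d dvd Suc n then mangoldt d else 0))"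
    by (intro sum.cong) (auto simp: div_Suc dvd_eq_mod_eq_0 algebra_simps)
  also have "\<dots> = ln (fact n) + (\<Sum>d\<in>{1..m}. if d dvd Suc n then mangoldt d else 0)"
    using Suc by (simp add: sum.distrib)
  also have "(\<Sum>d\<in>{1..m}. if d dvd Suc n then mangoldt d else 0)
      = (\<Sum>d | d dvd Suc n. mangoldt d :: real)"
  proof (rule sum.mono_neutral_cong_right)
    show "{d. d dvd Suc n} \<subseteq> {1..m}"
      using Suc.prems dvd_imp_le[of _ "Suc n"] dvd_pos_nat[of "Suc n"] by (force simp: Suc_le_eq)
  qed auto
  also have "\<dots> = ln (real (Suc n))" by (subst mangoldt_sum) auto
  finally show ?case
    by (simp add: ln_mult add.commute del: of_nat_Suc)
qed auto

text \<open>The weight \<open>q - \<lfloor>q/2\<rfloor> - \<lfloor>q/3\<rfloor> - \<lfloor>q/5\<rfloor> + \<lfloor>q/30\<rfloor>\<close> is \<open>30\<close>-periodic and takes only the values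
  \<open>0\<close> and \<open>1\<close>.\<close>

lemma chebyshev_weight:
  fixes q :: nat
  shows "q div 2 + q div 3 + q div 5 \<le> q + q div 30"
    and "q + q div 30 \<le> q div 2 + q div 3 + q div 5 + 1"
proof -
  define a r where "a = q div 30" and "r = q mod 30"
  have q: "q = r + a * 30" unfolding a_def r_def by simp
  have "q div 2 = r div 2 + a * 15" "q div 3 = r div 3 + a * 10" "q div 5 = r div 5 + a * 6"
    unfolding q by simp_all
  moreover have "\<forall>r\<in>set [0..<30::nat]. r div 2 + r div 3 + r div 5 \<le> r
      \<and> r \<le> r div 2 + r div 3 + r div 5 + 1"
    by code_simp
  moreover have "r \<in> set [0..<30]" by (simp add: r_def)
  ultimately show "q div 2 + q div 3 + q div 5 \<le> q + q div 30"
    and "q + q div 30 \<le> q div 2 + q div 3 + q div 5 + 1"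
    using q unfolding a_def[symmetric] by fastforce+
qed

lemma chebyshev_weight_eq_1:
  fixes q :: nat
  assumes "1 \<le> q" "q < 6"
  shows "q + q div 30 = q div 2 + q div 3 + q div 5 + 1"
proof -
  have "q \<in> {1,2,3,4,5}" using assms by auto
  thus ?thesis by auto
qed

text \<open>The logarithm of Chebyshev's integer \<open>(30N)! N! / ((15N)! (10N)! (6N)!)\<close>.\<close>

definition chebyshev_fact :: "nat \<Rightarrow> real" where
  "chebyshev_fact N = ln (fact (30 * N)) + ln (fact N)
     - ln (fact (15 * N)) - ln (fact (10 * N)) - ln (fact (6 * N))"

lemma chebyshev_fact_mangoldt:
  "chebyshev_fact N = (\<Sum>d\<in>{1..30 * N}. mangoldt d *
     (let q = 30 * N div d in real (q + q div 30) - real (q div 2 + q div 3 + q div 5)))"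
proof -
  have div: "30 * N div d div c = 30 * N div c div d" for c d
    by (simp add: mult.commute flip: div_mult2_eq)
  show ?thesis
    unfolding chebyshev_fact_def Let_def div[of _ 2] div[of _ 3] div[of _ 5] div[of _ 30]
    by (simp add: ln_fact_mangoldt[of _ "30 * N"] sum_subtractf sum.distrib algebra_simps)
qed

lemma chebyshev_fact_le_psi: "chebyshev_fact N \<le> chebyshev_psi (30 * N)"
  unfolding chebyshev_fact_mangoldt chebyshev_psi_def
proof (rule sum_mono)
  fix d
  have "real (q + q div 30) - real (q div 2 + q div 3 + q div 5) \<le> 1" for q
    using chebyshev_weight(2)[of q] by linarith
  thus "mangoldt d * (let q = 30 * N div d in real (q + q div 30) - real (q div 2 + q div 3 + q div 5))
      \<le> mangoldt d"
    unfolding Let_def by (intro mult_left_le mangoldt_nonneg)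
qed

lemma psi_diff_le_chebyshev_fact:
  "chebyshev_psi (30 * N) - chebyshev_psi (5 * N) \<le> chebyshev_fact N"
proof -
  let ?w = "\<lambda>q::nat. real (q + q div 30) - real (q div 2 + q div 3 + q div 5)"
  have nonneg: "0 \<le> ?w q" for q
    using chebyshev_weight(1)[of q] by linarith
  have "chebyshev_psi (30 * N) - chebyshev_psi (5 * N) = (\<Sum>d\<in>{1..30*N} - {1..5*N}. mangoldt d)"
    unfolding chebyshev_psi_def by (subst sum_diff) auto
  also have "\<dots> = (\<Sum>d\<in>{1..30*N} - {1..5*N}. mangoldt d * ?w (30 * N div d))"
  proof (rule sum.cong)
    fix d assume d: "d \<in> {1..30*N} - {1..5*N}"
    hence "1 \<le> 30 * N div d" "30 * N div d < 6"
      by (auto simp: Suc_le_eq div_greater_zero_iff div_less_iff_less_mult)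
    from chebyshev_weight_eq_1[OF this] have "?w (30 * N div d) = 1" by linarith
    thus "mangoldt d = mangoldt d * ?w (30 * N div d)" by simp
  qed simp
  also have "\<dots> \<le> (\<Sum>d\<in>{1..30*N}. mangoldt d * ?w (30 * N div d))"
    using nonneg by (intro sum_mono2) (auto intro!: mult_nonneg_nonneg mangoldt_nonneg)
  also have "\<dots> = chebyshev_fact N"
    by (simp add: chebyshev_fact_mangoldt Let_def)
  finally show ?thesis .
qed

lemma ln_add_one_bounds:
  fixes x :: real
  assumes "x > 0"
  shows "x * (ln (x + 1) - ln x) \<le> 1" "1 \<le> (x + 1) * (ln (x + 1) - ln x)"
proof -
  have "1 + 1 / x = (x + 1) / x"
    using assms by (simp add: field_simps)
  hence *: "ln (x + 1) - ln x = ln (1 + 1 / x)"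
    using assms by (simp add: ln_div)
  have "ln (1 + 1 / x) \<le> 1 / x"
    using assms by (intro ln_add_one_self_le_self) auto
  thus "x * (ln (x + 1) - ln x) \<le> 1"
    using assms * by (simp add: field_simps)
  have "ln (x / (x + 1)) \<le> x / (x + 1) - 1"
    using assms by (intro ln_le_minus_one) auto
  also have "\<dots> = - (1 / (x + 1))"
    using assms by (simp add: field_simps)
  finally have "1 / (x + 1) \<le> ln (x + 1) - ln x"
    using assms by (simp add: ln_div)
  thus "1 \<le> (x + 1) * (ln (x + 1) - ln x)"
    using assms by (simp add: field_simps)
qed

lemma ln_fact_bounds:
  assumes "n \<ge> 1"
  shows "real n * ln n - n \<le> ln (fact n)" "ln (fact n) \<le> real n * ln n - n + ln n + 1"
proof -
  have "real n * ln n - n \<le> ln (fact n) \<and> ln (fact n) \<le> real n * ln n - n + ln n + 1"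
    using assms
  proof (induction n rule: dec_induct)
    case (step n)
    have n: "real n > 0" using step by simp
    have "ln (fact (Suc n)) = ln (real n + 1) + ln (fact n)"
      using n by (simp add: ln_mult add.commute)
    thus ?case using step.IH ln_add_one_bounds[OF n] by (simp add: algebra_simps)
  qed auto
  thus "real n * ln n - n \<le> ln (fact n)" "ln (fact n) \<le> real n * ln n - n + ln n + 1"
    by auto
qed

text \<open>Both bounds are comparisons of \<open>2\<^sup>1\<^sup>4 3\<^sup>9 5\<^sup>5\<close> with a power of \<open>e\<close>; the constant is about
  \<open>27.639\<close>.\<close>

lemma chebyshev_constant_bounds:
  "27.6 \<le> 14 * ln 2 + 9 * ln 3 + 5 * ln (5::real)" "14 * ln 2 + 9 * ln 3 + 5 * ln (5::real) \<le> 28"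
proof -
  have eq: "14 * ln 2 + 9 * ln 3 + 5 * ln (5::real) = ln (2 ^ 14 * 3 ^ 9 * 5 ^ 5)"
    by (simp only: ln_mult ln_realpow zero_less_power zero_less_numeral mult_pos_pos of_nat_numeral)
       simp
  have "exp (27.6::real) ^ 5 = exp 1 ^ 138"
    by (simp flip: exp_of_nat_mult)
  also have "\<dots> \<le> (2.72::real) ^ 138"
    using e_less_272 by (intro power_mono) auto
  also have "\<dots> \<le> (2 ^ 14 * 3 ^ 9 * 5 ^ 5) ^ 5" by (simp add: power_divide)
  finally have "exp 27.6 \<le> (2 ^ 14 * 3 ^ 9 * 5 ^ 5 :: real)"
    by (rule power_le_imp_le_base[of _ 4, simplified]) simp
  thus "27.6 \<le> 14 * ln 2 + 9 * ln 3 + 5 * ln (5::real)"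
    unfolding eq by (subst ln_ge_iff) auto
  \<comment> \<open>The quadratic Taylor bound is applied at \<open>1/4\<close>, where it is sharp enough.\<close>
  have "2 ^ 14 * 3 ^ 9 * 5 ^ 5 \<le> (1 + 1/4 + (1/4)\<^sup>2 / 2 :: real) ^ 112"
    by (simp add: power2_eq_square power_divide)
  also have "\<dots> \<le> exp (1/4) ^ 112"
    by (intro power_mono exp_lower_Taylor_quadratic) auto
  also have "\<dots> = exp (28::real)" by (simp flip: exp_of_nat_mult)
  finally have "ln (2 ^ 14 * 3 ^ 9 * 5 ^ 5) \<le> ln (exp (28::real))"
    by (subst ln_le_cancel_iff) auto
  thus "14 * ln 2 + 9 * ln 3 + 5 * ln (5::real) \<le> 28"
    unfolding eq by (simp only: ln_exp)
qed

lemma chebyshev_fact_bounds: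
  assumes "N \<ge> 1"
  shows "27.6 * real N - 3 * ln N - 10 \<le> chebyshev_fact N"
    and "chebyshev_fact N \<le> 28 * real N + 2 * ln N + 5.5"
proof -
  have N: "real N > 0" using assms by simp
  have fact_lower: "real c * N * (ln c + ln N) - real c * N \<le> ln (fact (c * N))"
    and fact_upper: "ln (fact (c * N)) \<le> real c * N * (ln c + ln N) - real c * N + ln c + ln N + 1"
    if "c > 0" for c :: nat
    using ln_fact_bounds[of "c * N"] assms that N by (simp_all add: ln_mult)
  have e: "ln 30 = ln 2 + ln 3 + ln (5::real)" "ln 15 = ln 3 + ln (5::real)"
    "ln 10 = ln 2 + ln (5::real)" "ln 6 = ln 2 + ln (3::real)"
    by (simp_all flip: ln_mult_pos)
  \<comment> \<open>The coefficients of \<open>N ln N\<close> and of \<open>N\<close> cancel since \<open>30 + 1 = 15 + 10 + 6\<close>; what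
    remains of the main terms is \<open>c N\<close>.\<close>
  define c where "c = 14 * ln 2 + 9 * ln 3 + 5 * ln (5::real)"
  have l900: "2 * ln 2 + 2 * ln 3 + 2 * ln (5::real) \<le> 7"
  proof -
    have "2 * ln 2 + 2 * ln 3 + 2 * ln (5::real) = ln (2 ^ 2 * 3 ^ 2 * 5 ^ 2)"
      by (simp only: ln_mult ln_realpow zero_less_power zero_less_numeral mult_pos_pos) simp
    also have "\<dots> \<le> ln (2 ^ 10)" by simp
    also have "\<dots> = 10 * ln (2::real)" by (subst ln_realpow) auto
    also have "\<dots> \<le> 7" using ln2_le_25_over_36 by simp
    finally show ?thesis .
  qed
  have l30: "ln 2 + ln 3 + ln (5::real) \<le> 3.5"
    using l900 by simp
  have cN: "27.6 * real N \<le> c * N" "c * N \<le> 28 * real N"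
    using chebyshev_constant_bounds N by (auto simp: c_def intro!: mult_right_mono)
  have lower: "c * N - 3 * ln N - (2 * ln 2 + 2 * ln 3 + 2 * ln 5) - 3 \<le> chebyshev_fact N"
    unfolding chebyshev_fact_def
    using fact_lower[of 30] fact_lower[of 1] fact_upper[of 15] fact_upper[of 10] fact_upper[of 6]
    by (simp add: e c_def algebra_simps)
  have upper: "chebyshev_fact N \<le> c * N + 2 * ln N + (ln 2 + ln 3 + ln 5) + 2"
    unfolding chebyshev_fact_def
    using fact_upper[of 30] fact_upper[of 1] fact_lower[of 15] fact_lower[of 10] fact_lower[of 6]
    by (simp add: e c_def algebra_simps)
  show "27.6 * real N - 3 * ln N - 10 \<le> chebyshev_fact N"
    using lower l900 cN by linarith
  show "chebyshev_fact N \<le> 28 * real N + 2 * ln N + 5.5"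
    using upper l30 cN by linarith
qed

text \<open>The tangent of the logarithm at \<open>2\<^sup>j\<close>, with \<open>25/36\<close> as an upper bound for \<open>ln 2\<close>.\<close>

lemma ln_le_tangent:
  fixes x :: real
  assumes "x > 0"
  shows "ln x \<le> x / 2 ^ j + real j * (25 / 36) - 1"
proof -
  have "ln x = ln (x / 2 ^ j) + j * ln 2"
    using assms by (simp add: ln_div ln_realpow)
  also have "ln (x / 2 ^ j) \<le> x / 2 ^ j - 1"
    using assms by (intro ln_le_minus_one) auto
  also have "j * ln 2 \<le> j * (25 / 36 :: real)"
    using ln2_le_25_over_36 by (intro mult_left_mono) auto
  finally show ?thesis by simp
qed

text \<open>Iterating the bound for \<open>\<psi>(30N) - \<psi>(5N)\<close> along \<open>N, N/6, N/36, \<dots>\<close> would give the slope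
  \<open>28 \<cdot> 6/5 = 33.6\<close>; the larger slope \<open>36\<close> absorbs the logarithmic errors and the rounding of
  \<open>N/6\<close> as soon as \<open>N \<ge> 22\<close>, and the constant covers the smaller \<open>N\<close>.\<close>

lemma chebyshev_psi_upper: "chebyshev_psi (30 * N) \<le> 36 * real N + 200"
proof -
  have rec: "chebyshev_psi (30 * N) \<le> 28 * real N + 2 * ln N + 5.5 + chebyshev_psi (30 * K)"
    if "N \<ge> 1" "N \<le> 6 * K" for N K
    using psi_diff_le_chebyshev_fact[of N] chebyshev_fact_bounds(2)[of N]
      chebyshev_psi_mono[of "5 * N" "30 * K"] that by linarith
  have "chebyshev_psi 30 \<le> (\<Sum>d\<in>{1..30::nat}. 3.5)"
    unfolding chebyshev_psi_def
  proof (rule sum_mono)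
    fix d :: nat assume d: "d \<in> {1..30}"
    have "mangoldt d \<le> ln (real d)" using d by (intro mangoldt_le) auto
    also have "\<dots> \<le> ln (2 ^ 5)" using d by (subst ln_le_cancel_iff) auto
    also have "\<dots> = 5 * ln (2::real)" by (subst ln_realpow) auto
    also have "\<dots> \<le> 3.5" using ln2_le_25_over_36 by simp
    finally show "mangoldt d \<le> (3.5::real)" .
  qed
  hence psi_30: "chebyshev_psi 30 \<le> 105" by simp
  have tiny: "chebyshev_psi (30 * N) \<le> 28 * real N + 115" if "1 \<le> N" "N \<le> 6" for N
  proof -
    have "ln (real N) \<le> 2"
      using ln_le_tangent[of "real N" 2] that by simp
    thus ?thesis using rec[of N 1] psi_30 that by simp
  qed
  show ?thesis
  proof (induction N rule: less_induct)
    case (less N)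
    \<comment> \<open>\<open>N / 6\<close> is rounded up so that \<open>30 K \<ge> 5 N\<close>.\<close>
    define K where "K = (N + 5) div 6"
    have K: "N \<le> 6 * K" "6 * K \<le> N + 5" unfolding K_def by auto
    consider "N = 0" | "1 \<le> N" "N \<le> 6" | "7 \<le> N" "N < 22" | "22 \<le> N" by linarith
    thus ?case
    proof cases
      case 1
      thus ?thesis by (simp add: chebyshev_psi_def)
    next
      case 2
      thus ?thesis using tiny[of N] by simp
    next
      case 3
      hence "chebyshev_psi (30 * K) \<le> 28 * real K + 115" using K by (intro tiny) auto
      moreover have "ln (real N) \<le> real N / 16 + 1.8"
        using ln_le_tangent[of "real N" 4] 3 by simp
      ultimately show ?thesis using rec[of N K] K 3 by simp
    next
      case 4
      have "chebyshev_psi (30 * K) \<le> 36 * real K + 200"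
        using 4 K by (intro less) auto
      moreover have "ln (real N) \<le> real N / 32 + 2.48"
        using ln_le_tangent[of "real N" 5] 4 by simp
      ultimately show ?thesis using rec[of N K] K 4 by simp
    qed
  qed
qed

section \<open>Primes between \<open>n\<close> and \<open>3n/2\<close>\<close>

text \<open>Without primes in \<open>(m, n]\<close>, only proper prime powers contribute to \<open>\<psi>(n) - \<psi>(m)\<close>. A proper
  prime power \<open>p\<^sup>k \<le> n\<close> is \<open>x\<^sup>2\<close> or \<open>x\<^sup>2 p\<close> for \<open>x = p\<^bsup>k div 2\<^esup> \<le> \<surd>n\<close>, and \<open>x\<close> determines \<open>p\<close>, so
  there are at most \<open>2\<surd>n\<close> of them, each with \<open>\<Lambda>(p\<^sup>k) = ln p \<le> ln x\<close>. The number \<open>s\<close> stands for any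
  upper bound of \<open>\<lfloor>\<surd>n\<rfloor>\<close>.\<close>

lemma psi_diff_le_of_no_primes:
  fixes m n s :: nat
  assumes "\<And>p. prime p \<Longrightarrow> m < p \<Longrightarrow> n < p" and "n < (s + 1)\<^sup>2"
  shows "chebyshev_psi n - chebyshev_psi m \<le> 2 * real s * ln s"
proof -
  define Q where "Q = {d \<in> {1..n}. primepow d \<and> \<not> prime d}"
  define f where "f x = x\<^sup>2 * aprimedivisor x" for x :: nat
  have Q: "d \<in> (\<lambda>x. x\<^sup>2) ` {1..s} \<union> f ` {1..s} \<and> mangoldt d \<le> ln (real s)" if d: "d \<in> Q" for d
  proof -
    obtain p k where pk: "prime p" "d = p ^ k" "k > 0"
      using d by (auto simp: Q_def primepow_def)
    have p: "p > 1" using pk(1) by (rule prime_gt_1_nat)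
    have "k \<noteq> 1" using d pk by (auto simp: Q_def)
    define j where "j = k div 2"
    have j: "j > 0" "k = 2 * j \<or> k = 2 * j + 1"
      using pk \<open>k \<noteq> 1\<close> unfolding j_def by auto
    define x where "x = p ^ j"
    have apd: "aprimedivisor x = p"
      unfolding x_def using pk j by (simp add: aprimedivisor_prime_power)
    have "p ^ 1 \<le> x" unfolding x_def using p j by (intro power_increasing) auto
    hence "p \<le> x" by simp
    have x2: "x\<^sup>2 = p ^ (2 * j)" by (simp add: x_def mult.commute flip: power_mult)
    also have "\<dots> \<le> d" unfolding pk using p j by (intro power_increasing) auto
    also have "\<dots> < (s + 1)\<^sup>2" using d assms(2) by (simp add: Q_def)
    finally have "x < s + 1" by (rule power_less_imp_less_base) simp
    have "d = x\<^sup>2 \<or> d = f x"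
      using j(2) by (auto simp: pk(2) f_def apd x2)
    moreover have "x \<in> {1..s}" using \<open>x < s + 1\<close> \<open>p \<le> x\<close> p by auto
    ultimately have 1: "d \<in> (\<lambda>x. x\<^sup>2) ` {1..s} \<union> f ` {1..s}" by blast
    have "mangoldt d = ln (real p)" using pk by simp
    also have "\<dots> \<le> ln (real s)" using \<open>x < s + 1\<close> \<open>p \<le> x\<close> p by simp
    finally show ?thesis using 1 by simp
  qed
  have "card Q \<le> card ((\<lambda>x. x\<^sup>2) ` {1..s} \<union> f ` {1..s})"
    using Q by (intro card_mono) auto
  also have "\<dots> \<le> s + s"
    by (intro order.trans[OF card_Un_le] add_mono order.trans[OF card_image_le]) auto
  finally have card_Q: "real (card Q) \<le> 2 * real s" by simp
  have "chebyshev_psi n = (\<Sum>d\<in>{1..n} \<inter> {1..m}. mangoldt d) + (\<Sum>d\<in>{1..n} - {1..m}. mangoldt d)"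
    unfolding chebyshev_psi_def by (intro sum.Int_Diff) auto
  also have "(\<Sum>d\<in>{1..n} \<inter> {1..m}. mangoldt d) \<le> chebyshev_psi m"
    unfolding chebyshev_psi_def by (intro sum_mono2) (auto simp: mangoldt_nonneg)
  also have "(\<Sum>d\<in>{1..n} - {1..m}. mangoldt d) = (\<Sum>d | d \<in> {1..n} - {1..m} \<and> primepow d. mangoldt d :: real)"
    by (intro sum.mono_neutral_right) (auto simp: mangoldt_def)
  also have "\<dots> \<le> (\<Sum>d\<in>Q. mangoldt d)"
  proof (rule sum_mono2)
    show "{d \<in> {1..n} - {1..m}. primepow d} \<subseteq> Q"
    proof
      fix d assume "d \<in> {d \<in> {1..n} - {1..m}. primepow d}"
      hence d: "1 \<le> d" "d \<le> n" "m < d" "primepow d" by auto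
      hence "\<not> prime d" using assms(1)[of d] by linarith
      with d show "d \<in> Q" by (simp add: Q_def)
    qed
  qed (simp_all add: Q_def mangoldt_nonneg)
  also have "(\<Sum>d\<in>Q. mangoldt d) \<le> real (card Q) * ln (real s)"
    using Q by (intro sum_bounded_above) auto
  also have "\<dots> \<le> 2 * real s * ln s"
    using card_Q by (cases "s = 0") (auto intro!: mult_right_mono)
  finally show ?thesis by simp
qed

text \<open>With \<open>30A \<approx> 3n/2\<close> and \<open>30B \<approx> n\<close>, the estimates give \<open>\<psi>(30A) - \<psi>(30B) \<ge> 0.179 n - O(1)\<close>,
  whereas proper prime powers account only for \<open>O(\<surd>n ln n)\<close>.\<close>

lemma prime_between_large:
  fixes n :: nat
  assumes "n \<ge> 2 ^ 13"
  shows "\<exists>p. prime p \<and> n \<le> p \<and> 2 * p \<le> 3 * n"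
proof (rule ccontr)
  assume contr: "\<not> ?thesis"
  define A B where "A = n div 20" and "B = n div 30 + 1"
  define \<sigma> where "\<sigma> = sqrt (1.5 * real n)"
  define s where "s = nat \<lfloor>\<sigma>\<rfloor>"
  have A: "n \<le> 20 * A + 19" "20 * A \<le> n" "A \<ge> 1" and B: "n \<le> 30 * B" "30 * B \<le> n + 30"
    using assms unfolding A_def B_def by auto
  have \<sigma>2: "\<sigma>\<^sup>2 = 1.5 * n" by (simp add: \<sigma>_def)
  have "110 = sqrt (110\<^sup>2)" by simp
  also have "\<dots> \<le> \<sigma>" unfolding \<sigma>_def using assms by (intro real_sqrt_le_mono) auto
  finally have \<sigma>: "\<sigma> \<ge> 110" .
  have s: "real s \<le> \<sigma>" "\<sigma> < s + 1" "s \<ge> 1" using \<sigma> unfolding s_def by linarith+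
  have "real (30 * A) \<le> \<sigma>\<^sup>2" using A unfolding \<sigma>2 by simp
  also have "\<dots> < (real s + 1)\<^sup>2" using s \<sigma> by (intro power_strict_mono) auto
  finally have "30 * A < (s + 1)\<^sup>2"
    by (metis of_nat_1 of_nat_add of_nat_less_iff of_nat_power)
  hence "chebyshev_psi (30 * A) - chebyshev_psi (30 * B) \<le> 2 * real s * ln s"
  proof (rule psi_diff_le_of_no_primes[rotated])
    fix p assume "prime p" "30 * B < p"
    hence "3 * n < 2 * p" using contr B by (meson le_trans less_imp_le not_le)
    thus "30 * A < p" using A by linarith
  qed
  also have "\<dots> \<le> 2 * \<sigma> * ln \<sigma>"
    using s \<sigma> by (intro mult_mono) auto
  \<comment> \<open>The tangent at \<open>2\<^sup>7\<close>, which is close to the smallest \<open>\<sigma>\<close> that occurs.\<close>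
  also have "\<dots> \<le> 2 * \<sigma> * (\<sigma> / 128 + 3.8612)"
    using ln_le_tangent[of \<sigma> 7] \<sigma> by (intro mult_left_mono) auto
  also have "\<dots> = \<sigma>\<^sup>2 / 64 + 7.7224 * \<sigma>"
    by (simp add: power2_eq_square algebra_simps)
  finally have "chebyshev_psi (30 * A) - chebyshev_psi (30 * B) \<le> \<sigma>\<^sup>2 / 64 + 7.7224 * \<sigma>" .
  moreover have "chebyshev_psi (30 * B) \<le> 1.2 * real n + 236"
    using chebyshev_psi_upper[of B] B by simp
  moreover have "1.379 * real n - 69 \<le> chebyshev_psi (30 * A)"
  proof -
    have "27.6 * real A - 3 * ln A - 10 \<le> chebyshev_psi (30 * A)"
      using chebyshev_fact_bounds(1)[of A] chebyshev_fact_le_psi[of A] A by linarith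
    moreover have "ln (real A) \<le> real A / 65536 + 10.12"
      using ln_le_tangent[of "real A" 16] A by simp
    moreover have "real n \<le> 20 * real A + 19" using A by linarith
    ultimately show ?thesis by simp
  qed
  moreover have "110 * \<sigma> \<le> \<sigma>\<^sup>2" using \<sigma> by (simp add: power2_eq_square)
  ultimately show False using \<sigma> \<sigma>2 by simp
qed

lemma prime_int_trial_division:
  fixes p s :: int
  assumes "0 \<le> s" "1 < p" "p < (s + 1) * (s + 1)" "\<forall>d\<in>{2..s}. d * d \<le> p \<longrightarrow> p mod d \<noteq> 0"
  shows "prime p"
  unfolding prime_int_iff
proof (intro conjI allI impI)
  fix m :: int
  assume "0 \<le> m \<and> m dvd p"
  then obtain r where p: "p = m * r" and "0 \<le> m" by (auto elim: dvdE)
  have "0 < m * r" using p assms(2) by simp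
  hence pos: "0 < m" "0 < r" using \<open>0 \<le> m\<close> by (auto simp: zero_less_mult_iff)
  show "m = 1 \<or> m = p"
  proof (rule ccontr)
    assume "\<not> (m = 1 \<or> m = p)"
    hence "m \<noteq> 1" "r \<noteq> 1" by (auto simp: p)
    define d where "d = min m r"
    have d: "2 \<le> d" "d dvd p" using pos \<open>m \<noteq> 1\<close> \<open>r \<noteq> 1\<close> by (auto simp: d_def p min_def)
    have dd: "d * d \<le> p" unfolding p d_def using pos by (intro mult_mono) auto
    have "d \<le> s"
    proof (rule ccontr)
      assume "\<not> d \<le> s"
      hence "(s + 1) * (s + 1) \<le> d * d" using assms(1) d by (intro mult_mono) auto
      with dd assms(3) show False by linarith
    qed
    with d dd assms(4) show False by (auto simp: dvd_eq_mod_eq_0)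
  qed
qed (rule assms)

text \<open>Each member of the chain \<open>q # ps\<close> covers the numbers above its predecessor.\<close>

lemma prime_between_chain:
  fixes n q :: nat
  assumes "\<forall>p\<in>set ps. prime p" "successively (\<lambda>q p. 2 * p \<le> 3 * (q + 1)) (q # ps)"
    and "q < n" "n \<le> last (q # ps)"
  shows "\<exists>p. prime p \<and> n \<le> p \<and> 2 * p \<le> 3 * n"
  using assms
proof (induction ps arbitrary: q)
  case (Cons p ps)
  show ?case
  proof (cases "n \<le> p")
    case True
    thus ?thesis using Cons.prems by (intro exI[of _ p]) auto
  next
    case False
    thus ?thesis using Cons.prems by (intro Cons.IH[of p]) auto
  qed
qed auto

text \<open>After \<open>2\<close>, every entry of the chain is the largest prime that is at most \<open>3/2\<close> times the successor
  of its predecessor. All entries are below \<open>94\<^sup>2\<close>, so trial divisors up to \<open>93\<close> suffice. The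
  primality tests are evaluated on integers, whose code equations use binary numerals.\<close>

lemma prime_between_small:
  fixes n :: nat
  assumes "2 \<le> n" "n < 2 ^ 13"
  shows "\<exists>p. prime p \<and> n \<le> p \<and> 2 * p \<le> 3 * n"
proof -
  define ps :: "int list" where "ps = [2, 3, 5, 7, 11, 17, 23, 31, 47, 71, 107, 157, 233, 349, 523,
    773, 1153, 1723, 2579, 3863, 5791, 8681]"
  have "\<forall>p\<in>set ps. 1 < p \<and> p < (93 + 1) * (93 + 1) \<and> (\<forall>d\<in>set [2..93]. d * d \<le> p \<longrightarrow> p mod d \<noteq> 0)"
    unfolding ps_def by code_simp
  hence "\<forall>p\<in>set ps. prime p"
    unfolding set_upto by (intro ballI prime_int_trial_division[of 93]) simp_all
  hence "\<forall>p\<in>set (map nat ps). prime p"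
    by (simp only: prime_int_nat_transfer set_map ball_simps) blast
  thus ?thesis
  proof (rule prime_between_chain)
    show "successively (\<lambda>q p. 2 * p \<le> 3 * (q + 1)) (1 # map nat ps)" by (simp add: ps_def)
    show "1 < n" "n \<le> last (1 # map nat ps)" using assms by (simp_all add: ps_def)
  qed
qed

lemma prime_between:
  fixes n :: nat
  assumes "n \<ge> 2"
  shows "\<exists>p. prime p \<and> n \<le> p \<and> 2 * p \<le> 3 * n"
  using prime_between_small[OF assms] prime_between_large[of n] by (meson not_le)

section \<open>Modular Golomb rulers\<close>

lemma sidon_imp_modular_golomb_ruler:
  fixes L :: int
  assumes "X \<subseteq> {0..L}" "card X = k" "sidon_mod M X" "3 \<le> k" "2 * L < int v"
  shows "modular_golomb_ruler v k X"
proof -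
  have "X \<noteq> {}" using assms by auto
  hence L: "0 \<le> L" using assms(1) by fastforce
  have "inj_on (\<lambda>(x, y). (y - x) mod int v) {(x, y). x \<in> X \<and> y \<in> X \<and> x \<noteq> y}"
  proof (rule inj_onI, clarify)
    fix x y x' y'
    assume X: "x \<in> X" "y \<in> X" "x' \<in> X" "y' \<in> X" and "x \<noteq> y"
      and eq: "(y - x) mod int v = (y' - x') mod int v"
    have "int v dvd (y - x) - (y' - x')" using eq by (simp add: mod_eq_dvd_iff)
    moreover have "\<bar>(y - x) - (y' - x')\<bar> < int v"
    proof -
      have "{x, y, x', y'} \<subseteq> {0..L}" using X assms(1) by blast
      thus ?thesis using assms(5) by auto
    qed
    ultimately have "(y - x) - (y' - x') = 0"
      by (metis abs_of_nat dvd_imp_le_int not_le)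
    hence sums: "y + x' = y' + x" by simp
    hence "[y + x' = y' + x] (mod M)" by simp
    hence "y = y' \<or> y = x" using assms(3) X unfolding sidon_mod_def by blast
    thus "x = x' \<and> y = y'" using \<open>x \<noteq> y\<close> sums by auto
  qed
  moreover have "X \<subseteq> {0..int v - 1}" "0 < v"
    using assms(1,5) L by auto
  ultimately show ?thesis
    using assms(2,4) unfolding modular_golomb_ruler_def by blast
qed

theorem theorem2p6:
  fixes v k :: nat
  assumes "k \<ge> 3" and "v \<ge> 3 * k ^ 2 - 1"
  shows "\<exists>X. modular_golomb_ruler v k X"
proof -
  obtain p where p: "prime p" "k + 1 \<le> p" "2 * p \<le> 3 * (k + 1)"
    using prime_between[of "k + 1"] assms(1) by auto
  obtain X where X: "X \<subseteq> {0..(int k - 1) * int p}" "card X = k"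
    "sidon_mod (int p * (int p - 1)) X"
    using short_sidon_set[of p k] p assms(1) by auto
  have "2 * ((int k - 1) * int p) = (int k - 1) * int (2 * p)" by simp
  also have "\<dots> \<le> (int k - 1) * int (3 * (k + 1))"
    using p(3) assms(1) by (intro mult_left_mono) auto
  also have "\<dots> = 3 * int k ^ 2 - 3" by (simp add: algebra_simps power2_eq_square)
  also have "\<dots> < int (3 * k ^ 2 - 1)"
    using assms(1) by (simp add: of_nat_diff)
  also have "\<dots> \<le> int v" using assms(2) by simp
  finally show ?thesis
    using sidon_imp_modular_golomb_ruler[OF X assms(1)] by blast
qed

end
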